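(* For every absolutely continuous $f\in\Gamma$ with Hölder continuous derivative, the cardinality of the set $\mathfrak B(f)$ is equal to $2^{\mathfrak c}$.
   Context: $\ell_\infty$ is the space of bounded real sequences with the sup norm and coordinatewise order, and $\ell_\infty^*$ is its dual. $T$ is the left shift, $T(x_1,x_2,x_3,\dots)=(x_2,x_3,x_4,\dots)$. A Banach limit is a functional $B\in\ell_\infty^*$ with $B\ge 0$ (i.e. $Bx\ge0$ whenever $x\ge0$), $B(1,1,1,\dots)=1$, and $B(Tx)=Bx$ for all $x\in\ell_\infty$. $\mathfrak B$ is the set of all Banach limits. $\Gamma$ is the set of all non-decreasing functions $f$ on $[0,1]$ with $f(0)=0$ and $f(1)=1$. For $B\in\mathfrak B$ and $t\in[0,1]$, $\gamma(B,t)=B(y_t)$, where $y_t\in\ell_\infty$ is the indicator sequence of $\mathbb N\cap\bigcup_{n=1}^\infty[2^n,2^{n+t})$, i.e. $(y_t)_k=1$ if $2^n\le k<2^{n+t}$ for some $n\ge 1$ and $(y_t)_k=0$ otherwise. For $f\in\Gamma$, $\mathfrak B(f)=\{B\in\mathfrak B:\ \gamma(B,t)=f(t)\text{ for all }t\in[0,1]\}$. The derivative $f'$ is Hölder continuous if there are constants $K>0$ and $\alpha\in(0,1]$ with $|f'(s)-f'(t)|\le K|s-t|^\alpha$ for all $s,t\in[0,1]$ (one-sided derivatives at the endpoints). $\mathfrak c$ denotes the cardinality of the continuum. *)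

theory Defs
  imports "HOL-Analysis.Analysis"
begin

text \<open>
  A bounded sequence $(x_1, x_2, \ldots)$ is the function $i \mapsto x_{i+1}$ on \<^typ>\<open>nat\<close>:
  coordinates are counted from 0. As \<^typ>\<open>nat\<close> is discrete, the bounded continuous functions
  are all the bounded ones, and their library norm is the supremum norm.
\<close>

type_synonym linf = "nat \<Rightarrow>\<^sub>C real"

type_synonym linf_dual = "linf \<Rightarrow>\<^sub>L real"

definition left_shift :: "linf \<Rightarrow> linf" where
  "left_shift x = Bcontfun (\<lambda>i. apply_bcontfun x (Suc i))"

lemma apply_left_shift [simp]: "apply_bcontfun (left_shift x) i = apply_bcontfun x (Suc i)"
proof -
  have "bounded (range (\<lambda>i. apply_bcontfun x (Suc i)))"
    by (rule bounded_subset[OF bounded_apply_bcontfun[of x]]) auto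
  then have "(\<lambda>i. apply_bcontfun x (Suc i)) \<in> bcontfun"
    by (simp add: bcontfun_def)
  then show ?thesis
    by (simp add: left_shift_def Bcontfun_inverse)
qed

definition banach_limits :: "linf_dual set" where
  "banach_limits = {B.
     (\<forall>x. (\<forall>i. 0 \<le> apply_bcontfun x i) \<longrightarrow> 0 \<le> blinfun_apply B x) \<and>
     blinfun_apply B (const_bcontfun 1) = 1 \<and>
     (\<forall>x. blinfun_apply B (left_shift x) = blinfun_apply B x)}"

definition dyadic_set :: "real \<Rightarrow> nat set" where
  "dyadic_set t = {k. \<exists>n\<ge>1. 2 ^ n \<le> real k \<and> real k < 2 powr (real n + t)}"

text \<open>The argument \<open>Suc i\<close> undoes the offset between \<^typ>\<open>nat\<close> and the indices $1, 2, \ldots$.\<close>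

definition dyadic_indicator :: "real \<Rightarrow> linf" where
  "dyadic_indicator t = Bcontfun (\<lambda>i. indicator (dyadic_set t) (Suc i))"

lemma apply_dyadic_indicator [simp]:
  "apply_bcontfun (dyadic_indicator t) i = indicator (dyadic_set t) (Suc i)"
proof -
  have "bounded (range (\<lambda>i. indicator (dyadic_set t) (Suc i) :: real))"
    by (rule boundedI[where B = 1]) (auto simp: indicator_def)
  then have "(\<lambda>i. indicator (dyadic_set t) (Suc i) :: real) \<in> bcontfun"
    by (simp add: bcontfun_def)
  then show ?thesis
    by (simp add: dyadic_indicator_def Bcontfun_inverse)
qed

definition gamma_val :: "linf_dual \<Rightarrow> real \<Rightarrow> real" where
  "gamma_val B t = blinfun_apply B (dyadic_indicator t)"

text \<open>
  A function on $[0,1]$ is a total function of which only the values on \<^term>\<open>{0..1::real}\<close>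
  are ever used.
\<close>

definition monotone_Gamma :: "(real \<Rightarrow> real) set" where
  "monotone_Gamma = {f. mono_on {0..1} f \<and> f 0 = 0 \<and> f 1 = 1}"

definition banach_limits_of :: "(real \<Rightarrow> real) \<Rightarrow> linf_dual set" where
  "banach_limits_of f = {B \<in> banach_limits. \<forall>t\<in>{0..1}. gamma_val B t = f t}"

text \<open>
  Absolute continuity of a function, which is not the notion
  \<^const>\<open>absolutely_continuous\<close> for measures.
\<close>

definition abs_continuous_on :: "real \<Rightarrow> real \<Rightarrow> (real \<Rightarrow> real) \<Rightarrow> bool" where
  "abs_continuous_on a b f \<longleftrightarrow>
     (\<forall>\<epsilon>>0. \<exists>\<delta>>0. \<forall>(n::nat) u v.
        (\<forall>i<n. a \<le> u i \<and> u i \<le> v i \<and> v i \<le> b) \<longrightarrow>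
        disjoint_family_on (\<lambda>i. {u i<..<v i}) {..<n} \<longrightarrow>
        (\<Sum>i<n. v i - u i) < \<delta> \<longrightarrow>
        (\<Sum>i<n. \<bar>f (v i) - f (u i)\<bar>) < \<epsilon>)"

definition holder_continuous_on :: "real set \<Rightarrow> (real \<Rightarrow> real) \<Rightarrow> bool" where
  "holder_continuous_on S g \<longleftrightarrow>
     (\<exists>K>0. \<exists>\<alpha>>0. \<alpha> \<le> 1 \<and> (\<forall>s\<in>S. \<forall>t\<in>S. \<bar>g s - g t\<bar> \<le> K * \<bar>s - t\<bar> powr \<alpha>))"

text \<open>The filter \<open>at t within {a..b}\<close> makes the derivatives at the endpoints one-sided.\<close>

definition has_holder_derivative_on :: "real \<Rightarrow> real \<Rightarrow> (real \<Rightarrow> real) \<Rightarrow> bool" where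
  "has_holder_derivative_on a b f \<longleftrightarrow>
     (\<exists>f'. (\<forall>t\<in>{a..b}. (f has_real_derivative f' t) (at t within {a..b})) \<and>
           holder_continuous_on {a..b} f')"

end

theory Submission
  imports Defs
begin

text \<open>
  Averaging a sequence over the block \<open>[2\<^sup>n, 2\<^sup>n\<^sup>+\<^sup>1)\<close> with the weights
  \<open>f (log 2 ((k + 1) / 2\<^sup>n)) - f (log 2 (k / 2\<^sup>n))\<close> gives positive normalised functionals which
  map the dyadic indicator of \<open>t\<close> to approximately \<open>f t\<close>. As \<open>f'\<close> is continuous, the total
  variation of the weights tends to \<open>0\<close>, so every cluster point of these functionals is a
  Banach limit in \<open>B(f)\<close>. The functionals of different blocks have disjoint supports, so
  filters on \<open>\<nat>\<close> that are separated by sets yield different cluster points, and an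
  independent family of continuum many subsets of \<open>\<nat>\<close> provides \<open>2\<^sup>c\<close> such filters. Conversely
  the whole dual of \<open>l\<^sub>\<infinity>\<close> has at most \<open>2\<^sup>c\<close> elements.
\<close>

section \<open>Limits along filters\<close>

text \<open>A filter version of Banach-Alaoglu. By Tychonoff, the product of the intervals from
  \<open>- norm x\<close> to \<open>norm x\<close> is compact, so the image of \<open>F\<close>
  under \<phi> has a cluster point; pointwise limits inherit linearity and the norm bound.\<close>

lemma bounded_linear_cluster_functional:
  fixes \<phi> :: "'i \<Rightarrow> 'a::real_normed_vector \<Rightarrow> real"
  assumes F: "F \<noteq> bot"
    and lin: "\<And>i. linear (\<phi> i)"
    and bound: "\<And>i x. \<bar>\<phi> i x\<bar> \<le> norm x"
  obtains L :: "'a \<Rightarrow>\<^sub>L real" and G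
    where "G \<noteq> bot" "G \<le> F" "\<And>x. ((\<lambda>i. \<phi> i x) \<longlongrightarrow> blinfun_apply L x) G"
proof -
  define K where "K = Pi\<^sub>E (UNIV :: 'a set) (\<lambda>x. {- norm x .. norm x})"
  have "compactin (product_topology (\<lambda>i::'a. euclidean :: real topology) UNIV) K"
    unfolding K_def compactin_PiE by simp
  then have "compact K"
    by (simp add: euclidean_product_topology)
  moreover have "eventually (\<lambda>g. g \<in> K) (filtermap \<phi> F)"
    using bound by (simp add: eventually_filtermap K_def PiE_iff abs_le_iff minus_le_iff)
  moreover have "filtermap \<phi> F \<noteq> bot"
    using F by (simp add: filtermap_bot_iff)
  ultimately obtain l where l: "inf (nhds l) (filtermap \<phi> F) \<noteq> bot"
    unfolding compact_filter by blast
  \<comment> \<open>Meeting \<open>F\<close> with the pulled-back neighbourhoods of \<open>l\<close>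
    turns the cluster point into a genuine limit along \<open>G\<close>.\<close>
  define G where "G = inf (filtercomap \<phi> (nhds l)) F"
  have G: "G \<noteq> bot"
  proof
    assume "G = bot"
    then obtain P Q where PQ: "eventually P (filtercomap \<phi> (nhds l))" "eventually Q F"
        "\<And>x. P x \<Longrightarrow> Q x \<Longrightarrow> False"
      unfolding G_def trivial_limit_def eventually_inf by blast
    then obtain P' where P': "eventually P' (nhds l)" "\<And>x. P' (\<phi> x) \<Longrightarrow> P x"
      by (auto simp: eventually_filtercomap)
    have "eventually (\<lambda>g. \<not> P' g) (filtermap \<phi> F)"
      unfolding eventually_filtermap using PQ(2) by eventually_elim (use PQ(3) P'(2) in blast)
    then have "inf (nhds l) (filtermap \<phi> F) = bot"
      unfolding trivial_limit_def eventually_inf using P'(1) by blast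
    with l show False ..
  qed
  have "filterlim \<phi> (nhds l) G"
    unfolding filterlim_iff_le_filtercomap G_def by simp
  then have lim: "((\<lambda>i. \<phi> i x) \<longlongrightarrow> l x) G" for x
    using continuous_on_tendsto_compose[OF continuous_on_product_coordinates[of x], of \<phi> l G] by simp
  have "bounded_linear l"
  proof
    fix x y
    have "((\<lambda>i. \<phi> i (x + y)) \<longlongrightarrow> l x + l y) G"
      using tendsto_add[OF lim[of x] lim[of y]] by (simp add: linear_add[OF lin])
    then show "l (x + y) = l x + l y"
      using tendsto_unique[OF G lim] by blast
  next
    fix r x
    have "((\<lambda>i. \<phi> i (r *\<^sub>R x)) \<longlongrightarrow> r *\<^sub>R l x) G"
      using tendsto_scaleR[OF tendsto_const lim[of x]] by (simp add: linear_scale[OF lin])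
    then show "l (r *\<^sub>R x) = r *\<^sub>R l x"
      using tendsto_unique[OF G lim] by blast
  next
    show "\<exists>K. \<forall>x. norm (l x) \<le> norm x * K"
    proof (intro exI[of _ 1] allI)
      fix x
      show "norm (l x) \<le> norm x * 1"
        using tendsto_upperbound[OF tendsto_rabs[OF lim[of x]] _ G, of "norm x"] bound by simp
    qed
  qed
  then have "\<And>x. blinfun_apply (Blinfun l) x = l x"
    by (simp add: bounded_linear_Blinfun_apply)
  with G lim show thesis
    by (intro that[of G "Blinfun l"]) (auto simp: G_def)
qed

section \<open>Independent families of sets and of filters\<close>

text \<open>Finitely many pairs have finitely many first differences \<open>d Y Z\<close>; any
  initial segment containing all of these tells the sets apart.\<close>

lemma finite_sets_separated_by_initial_segment:
  fixes X :: "nat set set"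
  assumes "finite X"
  obtains N where "\<And>n. N \<le> n \<Longrightarrow> inj_on (\<lambda>Y. Y \<inter> {..<n}) X"
proof -
  define d where "d Y Z = (LEAST i::nat. (i \<in> Y) \<noteq> (i \<in> Z))" for Y Z
  have d: "(d Y Z \<in> Y) \<noteq> (d Y Z \<in> Z)" if "Y \<noteq> Z" for Y Z
    unfolding d_def by (rule LeastI_ex) (use that in auto)
  obtain N where N: "\<And>Y Z. Y \<in> X \<Longrightarrow> Z \<in> X \<Longrightarrow> d Y Z \<le> N"
    using finite_nat_set_iff_bounded_le[of "case_prod d ` (X \<times> X)"] assms by fastforce
  show thesis
  proof (rule that[of "Suc N"], rule inj_onI, rule ccontr)
    fix n Y Z
    assume n: "Suc N \<le> n" and YZ: "Y \<in> X" "Z \<in> X" "Y \<inter> {..<n} = Z \<inter> {..<n}" "Y \<noteq> Z"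
    then have "d Y Z < n"
      using N[of Y Z] by simp
    with YZ(3) d[OF YZ(4)] show False
      by blast
  qed
qed

text \<open>The Fichtenholz-Kantorovich-Hausdorff construction, indexed by all subsets of the
  naturals. Infinite rather than nonempty intersections are what makes the conditions compatible
  with \<open>sequentially\<close>.\<close>

lemma independent_family_of_nat_sets:
  obtains A :: "nat set \<Rightarrow> nat set"
    where "\<And>S X. finite X \<Longrightarrow> infinite {k. \<forall>Y\<in>X. k \<in> A Y \<longleftrightarrow> Y \<in> S}"
proof
  \<comment> \<open>\<open>k\<close> codes a length \<open>n\<close> together with a finite set of subsets of \<open>{..<n}\<close>;
    \<open>k \<in> A Y\<close> means that the trace of \<open>Y\<close> on \<open>{..<n}\<close> belongs to that set.\<close>
  define A where "A Y = {k. set_encode (Y \<inter> {..<fst (prod_decode k)}) \<in> set_decode (snd (prod_decode k))}"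
    for Y
  fix S X :: "nat set set"
  assume X: "finite X"
  obtain N where N: "\<And>n. N \<le> n \<Longrightarrow> inj_on (\<lambda>Y. Y \<inter> {..<n}) X"
    using finite_sets_separated_by_initial_segment[OF X] by blast
  \<comment> \<open>For \<open>n\<close> at least \<open>N\<close> the traces of the sets in
    \<open>X\<close> are distinct, so listing the traces of \<open>X \<inter> S\<close> singles out
    exactly the members of \<open>S\<close>. Each such \<open>n\<close> gives a different
    code.\<close>
  define c where "c n = prod_encode (n, set_encode ((\<lambda>Y. set_encode (Y \<inter> {..<n})) ` (X \<inter> S)))" for n
  have "c n \<in> A Y \<longleftrightarrow> Y \<in> S" if "N \<le> n" "Y \<in> X" for n Y
  proof -
    have "c n \<in> A Y \<longleftrightarrow> (\<exists>Z\<in>X \<inter> S. set_encode (Y \<inter> {..<n}) = set_encode (Z \<inter> {..<n}))"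
      using X by (auto simp: c_def A_def set_encode_inverse)
    also have "\<dots> \<longleftrightarrow> (\<exists>Z\<in>X \<inter> S. Y \<inter> {..<n} = Z \<inter> {..<n})"
      by (simp add: set_encode_eq)
    also have "\<dots> \<longleftrightarrow> Y \<in> S"
      using inj_onD[OF N[OF that(1)]] that(2) by blast
    finally show ?thesis .
  qed
  then have "c ` {N..} \<subseteq> {k. \<forall>Y\<in>X. k \<in> A Y \<longleftrightarrow> Y \<in> S}"
    by auto
  moreover have "inj_on c {N..}"
    by (rule inj_onI) (simp add: c_def)
  ultimately show "infinite {k. \<forall>Y\<in>X. k \<in> A Y \<longleftrightarrow> Y \<in> S}"
    using finite_imageD infinite_Ici infinite_super by blast
qed

text \<open>Every \<open>S\<close> prescribes membership in all the sets \<open>A Y\<close> at once;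
  independence is the finite intersection property needed for a proper filter. If \<open>S\<close>
  and \<open>T\<close> differ at \<open>Y\<close>, then \<open>A Y\<close> separates
  \<open>F S\<close> from \<open>F T\<close>.\<close>

lemma independent_family_of_filters:
  obtains A :: "nat set \<Rightarrow> nat set" and F :: "nat set set \<Rightarrow> nat filter"
    where "\<And>S. F S \<noteq> bot" "\<And>S. F S \<le> sequentially"
      "\<And>S Y. eventually (\<lambda>k. k \<in> A Y \<longleftrightarrow> Y \<in> S) (F S)"
proof -
  obtain A :: "nat set \<Rightarrow> nat set"
    where A: "\<And>S X. finite X \<Longrightarrow> infinite {k. \<forall>Y\<in>X. k \<in> A Y \<longleftrightarrow> Y \<in> S}"
    using independent_family_of_nat_sets by blast
  define P where "P S Y = inf sequentially (principal {k. k \<in> A Y \<longleftrightarrow> Y \<in> S})" for S Y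
  have le: "(INF Y. P S Y) \<le> P S Y" for S Y
    by (rule INF_lower) simp
  show thesis
  proof (rule that[of "\<lambda>S. INF Y. P S Y" A])
    fix S
    show "(INF Y. P S Y) \<noteq> bot"
    proof (rule INF_filter_not_bot)
      fix X :: "nat set set"
      assume X: "finite X"
      \<comment> \<open>Finitely many conditions cut out an infinite set, which meets every cofinite
        set; hence \<open>?Q\<close> is proper and lies below the finite infimum.\<close>
      let ?Q = "inf sequentially (principal {k. \<forall>Y\<in>X. k \<in> A Y \<longleftrightarrow> Y \<in> S})"
      have "?Q \<le> (INF Y\<in>X. P S Y)"
        unfolding P_def by (intro INF_greatest inf_mono order_refl) auto
      moreover have "?Q \<noteq> bot"
        using A[OF X, of S]
        by (simp add: trivial_limit_def eventually_inf_principal flip: cofinite_eq_sequentially)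
           (simp add: frequently_cofinite)
      ultimately show "(INF Y\<in>X. P S Y) \<noteq> bot"
        using le_bot[of ?Q] by (cases "(INF Y\<in>X. P S Y) = bot") simp_all
    qed
    show "(INF Y. P S Y) \<le> sequentially"
      using le[of S "{}"] by (auto simp: P_def)
    fix Y
    have "eventually (\<lambda>k. k \<in> A Y \<longleftrightarrow> Y \<in> S) (P S Y)"
      by (simp add: P_def eventually_inf_principal)
    then show "eventually (\<lambda>k. k \<in> A Y \<longleftrightarrow> Y \<in> S) (INF Y. P S Y)"
      using le filter_leD by blast
  qed
qed

section \<open>Cardinality of the dual\<close>

lemma lepoll_nat_sets_prod:
  assumes "A \<lesssim> (UNIV :: nat set set)" "B \<lesssim> (UNIV :: nat set set)"
  shows "A \<times> B \<lesssim> (UNIV :: nat set set)"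
proof -
  obtain a :: "_ \<Rightarrow> nat set" and b :: "_ \<Rightarrow> nat set" where ab: "inj_on a A" "inj_on b B"
    using assms by (auto simp: lepoll_def)
  have "inj_on (\<lambda>(x, y). a x <+> b y) (A \<times> B)"
  proof (intro inj_onI, clarsimp)
    fix x y x' y'
    assume xy: "x \<in> A" "y \<in> B" "x' \<in> A" "y' \<in> B" and "a x <+> b y = a x' <+> b y'"
    then have "a x = a x'" "b y = b y'"
      by (blast elim: PlusE)+
    then show "x = x' \<and> y = y'"
      using ab xy by (simp add: inj_on_eq_iff)
  qed
  then have "A \<times> B \<lesssim> (UNIV :: (nat + nat) set set)"
    unfolding lepoll_def by blast
  also have "(UNIV :: (nat + nat) set set) \<lesssim> (UNIV :: nat set set)"
    unfolding lepoll_def by (rule exI[of _ "image sum_encode"]) (simp add: inj_def inj_image_eq_iff[OF inj_sum_encode])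
  finally show ?thesis .
qed

text \<open>A sequence is coded by the subset of the plane whose \<open>i\<close>-th slice codes its
  \<open>i\<close>-th term as a set of naturals.\<close>

lemma linf_lepoll_nat_sets: "(UNIV :: linf set) \<lesssim> (UNIV :: nat set set)"
proof -
  obtain e :: "real \<Rightarrow> nat set" where e: "inj e"
    using eqpoll_imp_lepoll[OF eqpoll_sym[OF nat_sets_eqpoll_reals]] by (auto simp: lepoll_def)
  have "inj (\<lambda>x :: linf. Sigma UNIV (\<lambda>i. e (apply_bcontfun x i)))"
  proof (rule injI, rule bcontfun_eqI)
    fix x y :: linf and i
    assume "(SIGMA i:UNIV. e (apply_bcontfun x i)) = (SIGMA i:UNIV. e (apply_bcontfun y i))"
    then have "e (apply_bcontfun x i) = e (apply_bcontfun y i)"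
      by blast
    then show "apply_bcontfun x i = apply_bcontfun y i"
      using e by (simp add: inj_eq)
  qed
  then have "(UNIV :: linf set) \<lesssim> (UNIV :: (nat \<times> nat) set set)"
    unfolding lepoll_def by blast
  also have "(UNIV :: (nat \<times> nat) set set) \<lesssim> (UNIV :: nat set set)"
    unfolding lepoll_def by (rule exI[of _ "image prod_encode"]) (simp add: inj_def inj_image_eq_iff[OF inj_prod_encode])
  finally show ?thesis .
qed

text \<open>A functional is determined by its graph, a subset of a set of at most continuum many
  pairs.\<close>

lemma linf_dual_lepoll: "(UNIV :: linf_dual set) \<lesssim> (UNIV :: nat set set set)"
proof -
  have "(UNIV :: linf set) \<times> (UNIV :: real set) \<lesssim> (UNIV :: nat set set)"
    using linf_lepoll_nat_sets eqpoll_imp_lepoll[OF eqpoll_sym[OF nat_sets_eqpoll_reals]]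
    by (rule lepoll_nat_sets_prod)
  then obtain e :: "linf \<times> real \<Rightarrow> nat set" where e: "inj e"
    by (auto simp: lepoll_def)
  have "inj (\<lambda>B :: linf_dual. range (\<lambda>x. e (x, blinfun_apply B x)))"
  proof (rule injI, rule blinfun_eqI)
    fix B C :: linf_dual and x
    assume "range (\<lambda>x. e (x, blinfun_apply B x)) = range (\<lambda>x. e (x, blinfun_apply C x))"
    \<comment> \<open>Injectivity of \<open>e\<close> on pairs forces \<open>y = x\<close>, so the
      two values agree.\<close>
    then obtain y where "e (x, blinfun_apply B x) = e (y, blinfun_apply C y)"
      by blast
    then show "blinfun_apply B x = blinfun_apply C x"
      using e by (auto simp: inj_eq)
  qed
  then show ?thesis
    unfolding lepoll_def by blast
qed

lemma Pow_nat_sets_eqpoll_Pow_reals: "(UNIV :: nat set set set) \<approx> Pow (UNIV :: real set)"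
proof -
  obtain h :: "nat set \<Rightarrow> real" where "bij h"
    using nat_sets_eqpoll_reals by (auto simp: eqpoll_def)
  then have "bij_betw (image h) (Pow UNIV) (Pow UNIV)"
    by (rule bij_betw_Pow)
  then show ?thesis
    by (auto simp: eqpoll_def)
qed

section \<open>Weighted means over dyadic blocks\<close>

text \<open>Position \<open>k = 2 ^ n + j\<close> of the block is rescaled to
  \<open>k / 2 ^ n\<close> in \<open>{1..2}\<close>, with \<open>g\<close> as cumulative
  distribution of the weights. The \<open>- 1\<close> is the offset of coordinates counted from
  0.\<close>

definition block_mean :: "(real \<Rightarrow> real) \<Rightarrow> nat \<Rightarrow> linf \<Rightarrow> real" where
  "block_mean g n x = (\<Sum>j<2 ^ n. (g (1 + real (Suc j) / 2 ^ n) - g (1 + real j / 2 ^ n)) *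
     apply_bcontfun x (2 ^ n + j - 1))"

text \<open>These test sequences will tell apart functionals obtained along different
  filters.\<close>

definition block_indicator :: "nat set \<Rightarrow> linf" where
  "block_indicator A = Bcontfun (\<lambda>i. of_bool (\<exists>n\<in>A. 2 ^ n \<le> Suc i \<and> Suc i < 2 ^ Suc n))"

lemma apply_block_indicator [simp]:
  "apply_bcontfun (block_indicator A) i = of_bool (\<exists>n\<in>A. 2 ^ n \<le> Suc i \<and> Suc i < 2 ^ Suc n)"
proof -
  have "bounded (range (\<lambda>i. of_bool (\<exists>n\<in>A. 2 ^ n \<le> Suc i \<and> Suc i < 2 ^ Suc n) :: real))"
    by (rule boundedI[where B = 1]) auto
  then have "(\<lambda>i. of_bool (\<exists>n\<in>A. 2 ^ n \<le> Suc i \<and> Suc i < 2 ^ Suc n) :: real) \<in> bcontfun"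
    by (simp add: bcontfun_def)
  then show ?thesis
    by (simp add: block_indicator_def Bcontfun_inverse)
qed

lemma linear_block_mean: "linear (block_mean g n)"
  by (rule linearI)
     (simp_all add: block_mean_def distrib_left sum.distrib sum_distrib_left mult_ac)

lemma dyadic_block_unique:
  fixes k m n :: nat
  assumes "2 ^ m \<le> k" "k < 2 ^ Suc m" "2 ^ n \<le> k" "k < 2 ^ Suc n"
  shows "m = n"
proof -
  have "(2::nat) ^ m < 2 ^ Suc n" "(2::nat) ^ n < 2 ^ Suc m"
    using assms by linarith+
  then have "m < Suc n" "n < Suc m"
    by (simp_all only: power_strict_increasing_iff[of "2::nat"] one_less_numeral_iff semiring_norm)
  then show ?thesis
    by simp
qed

text \<open>As \<open>t\<close> is at most 1, the interval starting at \<open>2 ^ m\<close> stays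
  inside block \<open>m\<close>, so only \<open>m = n\<close> can witness membership; subtracting
  \<open>2 ^ n\<close> gives the condition on \<open>j\<close>.\<close>

lemma mem_dyadic_set_block:
  assumes n: "1 \<le> n" and j: "j < 2 ^ n" and t: "0 \<le> t" "t \<le> 1"
  shows "2 ^ n + j \<in> dyadic_set t \<longleftrightarrow> real j < 2 ^ n * (2 powr t - 1)"
proof -
  have eq: "2 powr (real n + t) = 2 ^ n * 2 powr t"
    by (simp add: powr_add powr_realpow)
  have "m = n" if "2 ^ m \<le> real (2 ^ n + j)" "real (2 ^ n + j) < 2 powr (real m + t)" for m
  proof (rule dyadic_block_unique[of _ "2 ^ n + j"])
    show "2 ^ m \<le> 2 ^ n + j"
      using that(1) by (metis of_nat_le_iff of_nat_numeral of_nat_power)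
    have "2 powr (real m + t) \<le> 2 powr real (Suc m)"
      using t by (intro powr_mono) auto
    also have "\<dots> = real (2 ^ Suc m)"
      by (subst powr_realpow) auto
    finally show "2 ^ n + j < 2 ^ Suc m"
      using that(2) by (metis of_nat_less_iff order_less_le_trans)
  qed (use j in auto)
  moreover have "2 ^ n \<le> real (2 ^ n + j)"
    by simp
  ultimately have "2 ^ n + j \<in> dyadic_set t \<longleftrightarrow> real (2 ^ n + j) < 2 powr (real n + t)"
    using n unfolding dyadic_set_def mem_Collect_eq by blast
  then show ?thesis
    unfolding eq by (simp add: algebra_simps)
qed

text \<open>Abel summation moves the differences from \<open>y\<close> to the weights, leaving two
  boundary terms.\<close>

lemma abs_sum_mult_diff_le:
  fixes w y :: "nat \<Rightarrow> real"
  assumes y: "\<And>j. \<bar>y j\<bar> \<le> C"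
  shows "\<bar>\<Sum>j<Suc m. w j * (y (Suc j) - y j)\<bar> \<le> C * (\<bar>w 0\<bar> + \<bar>w m\<bar> + (\<Sum>j<m. \<bar>w (Suc j) - w j\<bar>))"
proof -
  have "(\<Sum>j<Suc m. w j * (y (Suc j) - y j)) =
      w m * y (Suc m) - w 0 * y 0 - (\<Sum>j<m. (w (Suc j) - w j) * y (Suc j))"
    by (induction m) (simp_all add: algebra_simps)
  also have "\<bar>\<dots>\<bar> \<le> \<bar>w m * y (Suc m)\<bar> + \<bar>w 0 * y 0\<bar> + (\<Sum>j<m. \<bar>(w (Suc j) - w j) * y (Suc j)\<bar>)"
    using sum_abs[of "\<lambda>j. (w (Suc j) - w j) * y (Suc j)" "{..<m}"] by linarith
  also have "\<dots> \<le> \<bar>w m\<bar> * C + \<bar>w 0\<bar> * C + (\<Sum>j<m. \<bar>w (Suc j) - w j\<bar> * C)"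
    unfolding abs_mult by (intro add_mono sum_mono mult_left_mono y) auto
  also have "\<dots> = C * (\<bar>w 0\<bar> + \<bar>w m\<bar> + (\<Sum>j<m. \<bar>w (Suc j) - w j\<bar>))"
    by (simp add: algebra_simps sum_distrib_left)
  finally show ?thesis .
qed

section \<open>Block means of a continuously differentiable profile\<close>

text \<open>The profile will be \<open>f\<close> in the variable \<open>u = 2 powr t\<close>, in
  which consecutive integers of a block become equally spaced nodes.\<close>

locale smooth_block_profile =
  fixes g h :: "real \<Rightarrow> real"
  assumes mono: "mono_on {1..2} g"
    and endpoints: "g 1 = 0" "g 2 = 1"
    and deriv: "\<And>u. u \<in> {1..2} \<Longrightarrow> (g has_real_derivative h u) (at u within {1..2})"
    and cont: "continuous_on {1..2} h"
begin

definition weight :: "nat \<Rightarrow> nat \<Rightarrow> real" where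
  "weight n j = g (1 + real (Suc j) / 2 ^ n) - g (1 + real j / 2 ^ n)"

lemma block_mean_eq: "block_mean g n x = (\<Sum>j<2 ^ n. weight n j * apply_bcontfun x (2 ^ n + j - 1))"
  by (simp add: block_mean_def weight_def)

lemma node_mem: "j \<le> 2 ^ n \<Longrightarrow> 1 + real j / 2 ^ n \<in> {1..2}"
  using of_nat_mono[of j "2 ^ n", where 'a = real] by simp

lemma weight_nonneg: "j < 2 ^ n \<Longrightarrow> 0 \<le> weight n j"
  using mono_onD[OF mono node_mem[of j n] node_mem[of "Suc j" n]]
  by (simp add: weight_def divide_right_mono)

lemma sum_weight: "(\<Sum>j<p. weight n j) = g (1 + real p / 2 ^ n)"
  using sum_lessThan_telescope[of "\<lambda>j. g (1 + real j / 2 ^ n)" p]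
  by (simp add: weight_def endpoints)

lemma block_mean_nonneg: "(\<And>i. 0 \<le> apply_bcontfun x i) \<Longrightarrow> 0 \<le> block_mean g n x"
  unfolding block_mean_eq by (intro sum_nonneg mult_nonneg_nonneg weight_nonneg) auto

lemma block_mean_bound: "\<bar>block_mean g n x\<bar> \<le> norm x"
proof -
  have "\<bar>block_mean g n x\<bar> \<le> (\<Sum>j<2 ^ n. \<bar>weight n j * apply_bcontfun x (2 ^ n + j - 1)\<bar>)"
    unfolding block_mean_eq by (rule sum_abs)
  also have "\<dots> \<le> (\<Sum>j<2 ^ n. weight n j * norm x)"
    using norm_bounded[of x]
    by (intro sum_mono) (simp add: abs_mult weight_nonneg mult_left_mono)
  also have "\<dots> = norm x"
    by (simp add: sum_weight endpoints flip: sum_distrib_right)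
  finally show ?thesis .
qed

text \<open>The \<open>n\<close>-th mean sees only coordinates of block \<open>n\<close>, and
  distinct blocks are disjoint; the weights sum to 1.\<close>

lemma block_mean_block_indicator: "block_mean g n (block_indicator A) = of_bool (n \<in> A)"
proof -
  have "apply_bcontfun (block_indicator A) (2 ^ n + j - 1) = of_bool (n \<in> A)" if "j < 2 ^ n" for j
  proof -
    have "2 ^ n \<le> 2 ^ n + j" "2 ^ n + j < 2 ^ Suc n"
      using that by auto
    then have "(\<exists>m\<in>A. 2 ^ m \<le> 2 ^ n + j \<and> 2 ^ n + j < 2 ^ Suc m) \<longleftrightarrow> n \<in> A"
      using dyadic_block_unique[of _ "2 ^ n + j" n] by metis
    then show ?thesis
      by simp
  qed
  then show ?thesis
    unfolding block_mean_eq by (simp add: sum_weight endpoints)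
qed

lemma block_mean_const: "block_mean g n (const_bcontfun 1) = 1"
  by (simp add: block_mean_eq sum_weight endpoints)

text \<open>The mean value theorem on one node interval, of length \<open>1 / 2 ^ n\<close>.\<close>

lemma weight_mvt:
  assumes "j < 2 ^ n"
  obtains \<xi> where "\<xi> \<in> {1..2}" "\<xi> \<in> {1 + real j / 2 ^ n .. 1 + real (Suc j) / 2 ^ n}"
    "weight n j = h \<xi> / 2 ^ n"
proof -
  let ?a = "1 + real j / 2 ^ n" and ?b = "1 + real (Suc j) / 2 ^ n"
  have ab: "?a < ?b" "?a \<in> {1..2}" "?b \<in> {1..2}"
    using assms node_mem[of j n] node_mem[of "Suc j" n] by (simp_all add: divide_strict_right_mono)
  have "(g has_derivative (*) (h u)) (at u within {?a..?b})" if "?a \<le> u" "u \<le> ?b" for u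
  proof -
    have "u \<in> {1..2}" "{?a..?b} \<subseteq> {1..2}"
      using ab that unfolding atLeastAtMost_iff by (linarith, auto)
    then show ?thesis
      using has_field_derivative_subset[OF deriv] by (simp add: has_field_derivative_def)
  qed
  then obtain \<xi> where "\<xi> \<in> {?a<..<?b}" "g ?b - g ?a = h \<xi> * (?b - ?a)"
    using mvt_simple[OF ab(1), of g "\<lambda>u. (*) (h u)"] by blast
  moreover from this(1) ab have "\<xi> \<in> {1..2}"
    unfolding atLeastAtMost_iff greaterThanLessThan_iff by linarith
  ultimately show thesis
    by (intro that[of \<xi>]) (auto simp: weight_def field_simps)
qed

text \<open>The mean value points of adjacent intervals are at most \<open>2 / 2 ^ n\<close> apart,
  so uniform continuity of \<open>h\<close> makes the values of \<open>h\<close> there differ by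
  less than \<open>e\<close>.\<close>

lemma weight_regularity:
  assumes "0 < e"
  shows "eventually (\<lambda>n. \<forall>j. Suc j < 2 ^ n \<longrightarrow> \<bar>weight n (Suc j) - weight n j\<bar> \<le> e / 2 ^ n) sequentially"
proof -
  have "uniformly_continuous_on {1..2} h"
    by (intro compact_uniformly_continuous cont) auto
  then obtain d where d: "0 < d"
      "\<And>u v. u \<in> {1..2} \<Longrightarrow> v \<in> {1..2} \<Longrightarrow> \<bar>u - v\<bar> < d \<Longrightarrow> \<bar>h u - h v\<bar> < e"
    using assms unfolding uniformly_continuous_on_def dist_real_def by metis
  have "(\<lambda>n. 2 / 2 ^ n :: real) \<longlonglongrightarrow> 0"
    by (rule LIMSEQ_divide_realpow_zero) simp
  then have "eventually (\<lambda>n. 2 / 2 ^ n < d) sequentially"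
    by (rule order_tendstoD) (rule d)
  then show ?thesis
  proof eventually_elim
    case (elim n)
    show ?case
    proof (intro allI impI)
      fix j :: nat
      assume j: "Suc j < 2 ^ n"
      obtain u where u: "u \<in> {1..2}" "u \<in> {1 + real j / 2 ^ n .. 1 + real (Suc j) / 2 ^ n}"
          "weight n j = h u / 2 ^ n"
        using weight_mvt[of j n] j by auto
      obtain v where v: "v \<in> {1..2}"
          "v \<in> {1 + real (Suc j) / 2 ^ n .. 1 + real (Suc (Suc j)) / 2 ^ n}"
          "weight n (Suc j) = h v / 2 ^ n"
        using weight_mvt[of "Suc j" n] j by auto
      have "\<bar>v - u\<bar> \<le> 2 / 2 ^ n"
        using u(2) v(2) by (auto simp: abs_le_iff add_divide_distrib)
      then have "\<bar>h v - h u\<bar> < e"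
        using elim u(1) v(1) by (intro d) auto
      then show "\<bar>weight n (Suc j) - weight n j\<bar> \<le> e / 2 ^ n"
        by (simp add: u(3) v(3) abs_divide divide_right_mono flip: diff_divide_distrib)
    qed
  qed
qed

lemma weight_uniform_bound:
  obtains M where "0 \<le> M" "\<And>n j. j < 2 ^ n \<Longrightarrow> \<bar>weight n j\<bar> \<le> M / 2 ^ n"
proof -
  have "bounded (h ` {1..2})"
    by (intro compact_imp_bounded compact_continuous_image cont) auto
  then obtain M where "0 < M" and M: "\<And>u. u \<in> {1..2} \<Longrightarrow> \<bar>h u\<bar> \<le> M"
    by (auto simp: bounded_pos)
  moreover have "\<bar>weight n j\<bar> \<le> M / 2 ^ n" if j: "j < 2 ^ n" for n j
  proof -
    obtain \<xi> where "\<xi> \<in> {1..2}" "weight n j = h \<xi> / 2 ^ n"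
      using weight_mvt[OF j] by blast
    then show ?thesis
      using divide_right_mono[OF M[of \<xi>], of "2 ^ n"] by simp
  qed
  ultimately show thesis
    using that[of M] less_imp_le by blast
qed

text \<open>After summation by parts the boundary weights are of order \<open>1 / 2 ^ n\<close>, and
  fewer than \<open>2 ^ n\<close> weight differences of size at most \<open>e / 2 ^ n\<close> add up
  to at most \<open>e\<close>.\<close>

lemma block_mean_shift_invariant: "(\<lambda>n. block_mean g n (left_shift x - x)) \<longlonglongrightarrow> 0"
proof -
  let ?C = "norm x"
  obtain M where M: "0 \<le> M" "\<And>n j. j < 2 ^ n \<Longrightarrow> \<bar>weight n j\<bar> \<le> M / 2 ^ n"
    using weight_uniform_bound by blast
  have bound: "\<bar>block_mean g n (left_shift x - x)\<bar> \<le> ?C * (2 * M / 2 ^ n + e)"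
    if e: "\<forall>j. Suc j < 2 ^ n \<longrightarrow> \<bar>weight n (Suc j) - weight n j\<bar> \<le> e / 2 ^ n" "0 < e" for n e
  proof -
    obtain m where m: "2 ^ n = Suc m"
      using not0_implies_Suc[of "2 ^ n"] by auto
    \<comment> \<open>Since \<open>2 ^ n + j\<close> is positive, the shifted sequence has the value
      \<open>y (Suc j)\<close> where \<open>x\<close> has \<open>y j\<close>.\<close>
    define y where "y j = apply_bcontfun x (2 ^ n + j - 1)" for j
    have "block_mean g n (left_shift x - x) = (\<Sum>j<Suc m. weight n j * (y (Suc j) - y j))"
      unfolding block_mean_eq m by (intro sum.cong) (simp_all add: y_def m)
    also have "\<bar>\<dots>\<bar> \<le> ?C * (\<bar>weight n 0\<bar> + \<bar>weight n m\<bar> + (\<Sum>j<m. \<bar>weight n (Suc j) - weight n j\<bar>))"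
      using norm_bounded[of x] by (intro abs_sum_mult_diff_le) (simp add: y_def)
    also have "\<dots> \<le> ?C * (M / 2 ^ n + M / 2 ^ n + (\<Sum>j<m. e / 2 ^ n))"
      using e m by (intro mult_left_mono add_mono sum_mono M) auto
    also have "\<dots> \<le> ?C * (2 * M / 2 ^ n + e)"
    proof -
      have "real m \<le> 2 ^ n"
        using arg_cong[OF m, of real] by simp
      then have "real m * (e / 2 ^ n) \<le> e"
        using e(2) by (simp add: divide_le_eq mult.commute)
      then show ?thesis
        by (intro mult_left_mono) auto
    qed
    finally show ?thesis .
  qed
  show ?thesis
  proof (rule tendstoI)
    fix r :: real
    assume r: "0 < r"
    \<comment> \<open>The \<open>+ 1\<close> keeps the denominator positive when \<open>x\<close> is
      0, and still gives \<open>?C * e \<le> r / 2\<close>.\<close>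
    define e where "e = r / (2 * (?C + 1))"
    have e: "0 < e"
      using r by (auto simp: e_def intro!: divide_pos_pos add_nonneg_pos)
    have "?C * e < r"
    proof -
      have "?C * e \<le> (?C + 1) * e"
        using e by simp
      also have "\<dots> = r / 2"
        by (simp add: e_def field_simps add_nonneg_eq_0_iff)
      finally show ?thesis
        using r by simp
    qed
    moreover have "(\<lambda>n. ?C * (2 * M / 2 ^ n + e)) \<longlonglongrightarrow> ?C * (0 + e)"
      by (intro tendsto_intros LIMSEQ_divide_realpow_zero) simp
    ultimately have "eventually (\<lambda>n. ?C * (2 * M / 2 ^ n + e) < r) sequentially"
      by (intro order_tendstoD) auto
    with weight_regularity[OF e]
    show "eventually (\<lambda>n. dist (block_mean g n (left_shift x - x)) 0 < r) sequentially"
    proof eventually_elim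
      case (elim n)
      then show ?case
        using bound[OF elim(1) e] by simp
    qed
  qed
qed

text \<open>The indicator selects an initial piece of the block, so the weights telescope to
  \<open>g\<close> at a node converging to \<open>2 powr t\<close>.\<close>

lemma block_mean_dyadic_indicator:
  assumes t: "0 \<le> t" "t \<le> 1"
  shows "(\<lambda>n. block_mean g n (dyadic_indicator t)) \<longlonglongrightarrow> g (2 powr t)"
proof -
  define s where "s = 2 powr t - 1"
  have s: "0 \<le> s" "s \<le> 1"
    using t powr_mono[of 0 t 2] powr_mono[of t 1 2] by (auto simp: s_def)
  \<comment> \<open>The number of naturals \<open>j\<close> with \<open>j < 2 ^ n * s\<close>, that
    is, of block members in the dyadic set.\<close>
  define p where "p n = nat \<lceil>2 ^ n * s\<rceil>" for n :: nat
  have p: "2 ^ n * s \<le> real (p n)" "real (p n) \<le> 2 ^ n * s + 1" "p n \<le> 2 ^ n" for n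
  proof -
    have "0 \<le> 2 ^ n * s" "2 ^ n * s \<le> 2 ^ n"
      using s by (auto simp: mult_left_le)
    then show "2 ^ n * s \<le> real (p n)" "real (p n) \<le> 2 ^ n * s + 1" "p n \<le> 2 ^ n"
      unfolding p_def by (auto simp: nat_le_iff ceiling_le_iff)
  qed
  have "block_mean g n (dyadic_indicator t) = g (1 + real (p n) / 2 ^ n)" if n: "1 \<le> n" for n
  proof -
    have "block_mean g n (dyadic_indicator t) = (\<Sum>j<2 ^ n. if j < p n then weight n j else 0)"
      unfolding block_mean_eq
      using mem_dyadic_set_block[OF n _ t]
      by (intro sum.cong) (auto simp: indicator_def p_def s_def zless_nat_eq_int_zless less_ceiling_iff)
    also have "\<dots> = (\<Sum>j\<in>{..<2 ^ n} \<inter> {..<p n}. weight n j)"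
      by (simp add: sum.inter_restrict)
    also have "{..<2 ^ n} \<inter> {..<p n} = {..<p n}"
      using p(3)[of n] by auto
    finally show ?thesis
      by (simp add: sum_weight)
  qed
  \<comment> \<open>The start at 1 matches \<open>dyadic_set\<close>, whose blocks begin with
    \<open>n = 1\<close>.\<close>
  then have eq: "eventually (\<lambda>n. g (1 + real (p n) / 2 ^ n) = block_mean g n (dyadic_indicator t)) sequentially"
    by (intro eventually_sequentiallyI[of 1]) simp
  have "(\<lambda>n. real (p n) / 2 ^ n) \<longlonglongrightarrow> s"
  proof (rule tendsto_sandwich)
    show "\<forall>\<^sub>F n in sequentially. s \<le> real (p n) / 2 ^ n"
      using p(1) by (auto simp: field_simps)
    show "\<forall>\<^sub>F n in sequentially. real (p n) / 2 ^ n \<le> s + 1 / 2 ^ n"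
      using p(2) by (auto simp: field_simps)
    show "(\<lambda>n. s + 1 / 2 ^ n) \<longlonglongrightarrow> s"
      using tendsto_add[OF tendsto_const LIMSEQ_divide_realpow_zero[of 2 1], of s] by simp
  qed simp
  then have "(\<lambda>n. 1 + real (p n) / 2 ^ n) \<longlonglongrightarrow> 1 + s"
    by (intro tendsto_intros)
  moreover have "continuous_on {1..2} g"
    using deriv by (rule DERIV_continuous_on)
  ultimately have "(\<lambda>n. g (1 + real (p n) / 2 ^ n)) \<longlonglongrightarrow> g (1 + s)"
    using s node_mem[OF p(3)] by (intro continuous_on_tendsto_compose[where s = "{1..2}" and f = g]) auto
  then show ?thesis
    using Lim_transform_eventually[OF _ eq] by (simp add: s_def)
qed

text \<open>Each \<open>S\<close> yields a cluster functional along \<open>F S\<close>. Its values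
  on the sequences \<open>block_indicator (A Y)\<close> are 1 or 0 according to whether
  \<open>Y\<close> lies in \<open>S\<close>, so \<open>S\<close> can be read off from it.\<close>

lemma many_banach_limits:
  fixes f :: "real \<Rightarrow> real"
  assumes f: "\<And>t. t \<in> {0..1} \<Longrightarrow> f t = g (2 powr t)"
  shows "(UNIV :: nat set set set) \<lesssim> banach_limits_of f"
proof -
  obtain A :: "nat set \<Rightarrow> nat set" and F
    where F: "\<And>S. F S \<noteq> bot" "\<And>S. F S \<le> sequentially"
      and A: "\<And>S Y. eventually (\<lambda>k. k \<in> A Y \<longleftrightarrow> Y \<in> S) (F S)"
    using independent_family_of_filters by metis
  have "\<exists>B \<in> banach_limits_of f. \<forall>Y. blinfun_apply B (block_indicator (A Y)) = of_bool (Y \<in> S)" for S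
  proof -
    obtain B G where G: "G \<noteq> bot" "G \<le> F S"
      and B: "\<And>x. ((\<lambda>n. block_mean g n x) \<longlongrightarrow> blinfun_apply B x) G"
      by (rule bounded_linear_cluster_functional[OF F(1)[of S], of "block_mean g"])
         (blast intro: linear_block_mean block_mean_bound)+
    have value_eq: "blinfun_apply B x = c" if "((\<lambda>n. block_mean g n x) \<longlongrightarrow> c) G" for x c
      using tendsto_unique[OF G(1) B that] .
    have seq: "(a \<longlongrightarrow> c) G" if "a \<longlonglongrightarrow> c" for a :: "nat \<Rightarrow> real" and c
      using that G(2) F(2) by (meson order_trans tendsto_mono)
    have "B \<in> banach_limits"
      unfolding banach_limits_def mem_Collect_eq
    proof (intro conjI allI impI)
      fix x :: linf
      assume "\<forall>i. 0 \<le> apply_bcontfun x i"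
      then show "0 \<le> blinfun_apply B x"
        by (intro tendsto_lowerbound[OF B _ G(1)]) (simp add: block_mean_nonneg)
    next
      show "blinfun_apply B (const_bcontfun 1) = 1"
        by (rule value_eq) (simp add: block_mean_const)
    next
      fix x
      show "blinfun_apply B (left_shift x) = blinfun_apply B x"
        using value_eq[OF seq[OF block_mean_shift_invariant[of x]]] by (simp add: blinfun.diff_right)
    qed
    moreover have "gamma_val B t = f t" if "t \<in> {0..1}" for t
      unfolding gamma_val_def f[OF that]
      using that by (intro value_eq seq block_mean_dyadic_indicator) auto
    moreover have "blinfun_apply B (block_indicator (A Y)) = of_bool (Y \<in> S)" for Y
    proof (rule value_eq, rule tendsto_eventually)
      show "\<forall>\<^sub>F n in G. block_mean g n (block_indicator (A Y)) = of_bool (Y \<in> S)"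
        using filter_leD[OF G(2) A[of Y S]]
        by eventually_elim (simp add: block_mean_block_indicator)
    qed
    ultimately show ?thesis
      unfolding banach_limits_of_def by blast
  qed
  then obtain b where b: "\<And>S. b S \<in> banach_limits_of f"
      "\<And>S Y. blinfun_apply (b S) (block_indicator (A Y)) = of_bool (Y \<in> S)"
    by metis
  have "inj b"
  proof (rule injI, rule set_eqI)
    fix S T Y
    assume "b S = b T"
    then show "Y \<in> S \<longleftrightarrow> Y \<in> T"
      using b(2)[of S Y] b(2)[of T Y] by (simp add: of_bool_eq_iff)
  qed
  with b(1) show ?thesis
    unfolding lepoll_def by blast
qed

end

section \<open>Passage from \<open>f\<close> to its logarithmic profile, and the cardinality\<close>

lemma holder_continuous_on_imp_continuous_on:
  assumes "holder_continuous_on S g"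
  shows "continuous_on S g"
proof -
  obtain K \<alpha> where \<alpha>: "0 < \<alpha>"
    and K: "\<And>s t. s \<in> S \<Longrightarrow> t \<in> S \<Longrightarrow> \<bar>g s - g t\<bar> \<le> K * \<bar>s - t\<bar> powr \<alpha>"
    using assms unfolding holder_continuous_on_def by blast
  have "(g \<longlongrightarrow> g t) (at t within S)" if t: "t \<in> S" for t
  proof (rule Lim_null_comparison[THEN LIM_zero_cancel])
    show "\<forall>\<^sub>F s in at t within S. norm (g s - g t) \<le> K * \<bar>s - t\<bar> powr \<alpha>"
      using K t by (auto simp: eventually_at_filter)
    have "((\<lambda>s. K * \<bar>s - t\<bar> powr \<alpha>) \<longlongrightarrow> K * \<bar>t - t\<bar> powr \<alpha>) (at t within S)"
      using \<alpha> by (intro tendsto_intros) auto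
    then show "((\<lambda>s. K * \<bar>s - t\<bar> powr \<alpha>) \<longlongrightarrow> 0) (at t within S)"
      by simp
  qed
  then show ?thesis
    by (simp add: continuous_on_def)
qed

text \<open>The binary logarithm maps \<open>{1..2}\<close> increasingly into \<open>{0..1}\<close>;
  the chain rule relative to these sets also covers the one-sided derivatives at the
  endpoints.\<close>

lemma smooth_block_profile_log:
  assumes f: "f \<in> monotone_Gamma"
    and f': "\<And>t. t \<in> {0..1} \<Longrightarrow> (f has_real_derivative f' t) (at t within {0..1})"
    and cont: "continuous_on {0..1} f'"
  shows "smooth_block_profile (\<lambda>u. f (log 2 u)) (\<lambda>u. f' (log 2 u) * (1 / (ln 2 * u)))"
proof
  have log: "log 2 u \<in> {0..1}" if "u \<in> {1..2}" for u :: real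
    using that by simp
  show "mono_on {1..2} (\<lambda>u. f (log 2 u))"
  proof (rule mono_onI)
    fix r s :: real
    assume rs: "r \<in> {1..2}" "s \<in> {1..2}" "r \<le> s"
    then have "log 2 r \<le> log 2 s"
      by simp
    then show "f (log 2 r) \<le> f (log 2 s)"
      using f log rs by (auto simp: monotone_Gamma_def intro: mono_onD)
  qed
  show "f (log 2 1) = 0" "f (log 2 2) = 1"
    using f by (auto simp: monotone_Gamma_def)
  show "((\<lambda>u. f (log 2 u)) has_real_derivative f' (log 2 u) * (1 / (ln 2 * u))) (at u within {1..2})"
    if u: "u \<in> {1..2}" for u
  proof -
    have "log 2 ` {1..2} \<subseteq> {0..1}"
      using log by blast
    moreover have "(log 2 has_real_derivative 1 / (ln 2 * u)) (at u within {1..2})"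
      using u by (auto intro!: derivative_eq_intros)
    ultimately have "(f \<circ> log 2 has_real_derivative f' (log 2 u) * (1 / (ln 2 * u))) (at u within {1..2})"
      by (intro DERIV_image_chain has_field_derivative_subset[OF f'[OF log[OF u]]])
    then show ?thesis
      by (simp only: o_def)
  qed
  show "continuous_on {1..2} (\<lambda>u. f' (log 2 u) * (1 / (ln 2 * u)))"
    using log by (intro continuous_intros continuous_on_compose2[OF cont]) auto
qed

theorem corollary4p5:
  fixes f :: "real \<Rightarrow> real"
  assumes "f \<in> monotone_Gamma"
    and "abs_continuous_on 0 1 f"
    and "has_holder_derivative_on 0 1 f"
  shows "banach_limits_of f \<approx> Pow (UNIV :: real set)"
proof -
  obtain f' where "\<And>t. t \<in> {0..1} \<Longrightarrow> (f has_real_derivative f' t) (at t within {0..1})"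
      "continuous_on {0..1} f'"
    using assms(3) holder_continuous_on_imp_continuous_on
    unfolding has_holder_derivative_on_def by blast
  then interpret smooth_block_profile "\<lambda>u. f (log 2 u)" "\<lambda>u. f' (log 2 u) * (1 / (ln 2 * u))"
    by (rule smooth_block_profile_log[OF assms(1)])
  have "(UNIV :: nat set set set) \<lesssim> banach_limits_of f"
    \<comment> \<open>The remaining condition is \<open>log 2 (2 powr t) = t\<close>.\<close>
    by (rule many_banach_limits) simp
  moreover have "banach_limits_of f \<lesssim> (UNIV :: nat set set set)"
    using subset_imp_lepoll[of "banach_limits_of f" UNIV] linf_dual_lepoll by (rule lepoll_trans) simp
  ultimately have "banach_limits_of f \<approx> (UNIV :: nat set set set)"
    by (intro lepoll_antisym)
  then show ?thesis
    using Pow_nat_sets_eqpoll_Pow_reals by (rule eqpoll_trans)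
qed

end
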